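(* Let $\mathcal{H}\cong\mathbb{C}^n$ and let $\mathbf{U}$ be a unitary operator on $\mathcal{H}$. Let $\Gamma$ be the GKLS vector field on $\mathfrak{T}_1$ of the quantum Poisson semigroup with generator $\mathbf{L}(\xi)=-\xi+\mathbf{U}\,\xi\,\mathbf{U}^\dagger$, that is, $$\Gamma=\mathrm{Tr}\left(\mathbf{U}\,\mathbf{e}_l\,\mathbf{U}^\dagger\,\mathbf{e}^k\right)x^l\frac{\partial}{\partial x^k}-\Delta .$$ Then the function $F(\xi)=\frac12\mathrm{Tr}(\xi^2)$ is a LaSalle function for $\Gamma$.
   Context: $\mathfrak{O}^*$ is the space of self-adjoint $n\times n$ matrices (identified with the dual of the space $\mathfrak{O}$ of self-adjoint operators on $\mathcal{H}$ via the trace), $\mathfrak{T}_1=\{\xi\in\mathfrak{O}^*:\mathrm{Tr}\,\xi=1\}$, and $\mathcal{S}\subset\mathfrak{T}_1$ is the compact set of quantum states (positive semidefinite matrices of trace $1$). Let $\{\mathbf{e}^\mu\}_{\mu=0}^{n^2-1}$ be a basis of $\mathfrak{O}$ orthonormal for the trace inner product with $\mathbf{e}^0=\mathbb{I}/\sqrt n$, and $\mathbf{e}_\mu$ the dual basis (the same matrices). Points of $\mathfrak{T}_1$ are written $\xi=\frac1{\sqrt n}\mathbf{e}_0+x^l\mathbf{e}_l$, with summed Latin indices running over $1,\dots,n^2-1$, so $(x^k)$ are global coordinates on $\mathfrak{T}_1$; $\Delta=x^k\frac{\partial}{\partial x^k}$. LaSalle function: let $\Gamma$ be a complete smooth vector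 field on $\mathfrak{T}_1$ whose flow maps $\mathcal{S}$ into itself for all times $\tau\ge0$ (GKLS vector fields have this property, since $e^{\tau\mathbf{L}}$ is completely positive and trace preserving for $\tau\ge0$). A function $F:\mathfrak{T}_1\to\mathbb{R}$ is a LaSalle function for $\Gamma$ if $F$ is smooth, $F\ge0$ on $\mathcal{S}$, and the Lie derivative satisfies $\mathcal{L}_\Gamma F\le0$ at every point of $\mathcal{S}$. *)

theory Defs
  imports "HOL-Analysis.Analysis"
begin

type_synonym 'n cmat = "complex^'n^'n"

definition dagger :: "'n::finite cmat \<Rightarrow> 'n cmat" where
  "dagger A = (\<chi> i j. cnj (A $ j $ i))"

definition unitary_matrix :: "'n::finite cmat \<Rightarrow> bool" where
  "unitary_matrix U \<longleftrightarrow> dagger U ** U = mat 1 \<and> U ** dagger U = mat 1"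

definition self_adjoint :: "'n::finite cmat set" where
  "self_adjoint = {A. dagger A = A}"

definition trace_one :: "'n::finite cmat set" where
  "trace_one = {\<xi> \<in> self_adjoint. trace \<xi> = 1}"

text \<open>The tangent space of the affine space \<^const>\<open>trace_one\<close>, the same at every point.\<close>

definition trace_zero :: "'n::finite cmat set" where
  "trace_zero = {v \<in> self_adjoint. trace v = 0}"

text \<open>For self-adjoint \<open>\<xi>\<close> the form \<open>\<langle>v, \<xi> v\<rangle>\<close> is real, so taking its real part loses nothing.\<close>

definition states :: "'n::finite cmat set" where
  "states = {\<xi> \<in> trace_one. \<forall>v::complex^'n. 0 \<le> Re (\<Sum>i\<in>UNIV. cnj (v $ i) * (\<xi> *v v) $ i)}"

text \<open>
  A basis of the real vector space of self-adjoint matrices, orthonormal for the trace inner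
  product, with normalised identity as element 0. Under the trace identification of self-adjoint
  matrices with their dual, the dual basis consists of the same matrices.
\<close>

definition trace_orthonormal_basis :: "(nat \<Rightarrow> 'n::finite cmat) \<Rightarrow> bool" where
  "trace_orthonormal_basis e \<longleftrightarrow>
     (\<forall>\<mu> < CARD('n)\<^sup>2. e \<mu> \<in> self_adjoint) \<and>
     (\<forall>\<mu> < CARD('n)\<^sup>2. \<forall>\<nu> < CARD('n)\<^sup>2. trace (e \<mu> ** e \<nu>) = (if \<mu> = \<nu> then 1 else 0)) \<and>
     span (e ` {..<CARD('n)\<^sup>2}) = self_adjoint \<and>
     e 0 = (1 / sqrt (real CARD('n))) *\<^sub>R mat 1"

text \<open>
  Only the values \<open>x k\<close> with \<open>1 \<le> k \<le> n\<^sup>2 - 1\<close> matter below. The coordinate vector field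
  \<open>\<partial>/\<partial>x\<^sup>k\<close> is the constant tangent vector \<open>e k\<close>.
\<close>

definition point_of_coords :: "(nat \<Rightarrow> 'n::finite cmat) \<Rightarrow> (nat \<Rightarrow> real) \<Rightarrow> 'n cmat" where
  "point_of_coords e x =
     (1 / sqrt (real CARD('n))) *\<^sub>R e 0 + (\<Sum>l\<in>{1..<CARD('n)\<^sup>2}. x l *\<^sub>R e l)"

definition poisson_generator :: "'n::finite cmat \<Rightarrow> 'n cmat \<Rightarrow> 'n cmat" where
  "poisson_generator U \<xi> = - \<xi> + U ** \<xi> ** dagger U"

text \<open>
  The vector field on \<^const>\<open>trace_one\<close> of the evolution equation \<open>\<xi>' = L \<xi>\<close>; vector fields are
  functions into the fixed tangent space, and their values off \<^const>\<open>trace_one\<close> are irrelevant.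
\<close>

definition gkls_vector_field ::
    "('n::finite cmat \<Rightarrow> 'n cmat) \<Rightarrow> 'n cmat \<Rightarrow> 'n cmat" where
  "gkls_vector_field L = (\<lambda>\<xi>. if \<xi> \<in> trace_one then L \<xi> else 0)"

text \<open>
  Differentiability of class \<open>C\<^sup>k\<close> on the affine space \<^const>\<open>trace_one\<close>. A derivative within
  this set is uniquely determined exactly on tangent vectors, so only those directions are used.
\<close>

primrec Ck_trace_one :: "nat \<Rightarrow> ('n::finite cmat \<Rightarrow> 'b::real_normed_vector) \<Rightarrow> bool" where
  "Ck_trace_one 0 f \<longleftrightarrow> continuous_on trace_one f"
| "Ck_trace_one (Suc k) f \<longleftrightarrow>
     (\<exists>f'. (\<forall>\<xi>\<in>trace_one. (f has_derivative f' \<xi>) (at \<xi> within trace_one)) \<and>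
           (\<forall>v\<in>trace_zero. Ck_trace_one k (\<lambda>\<xi>. f' \<xi> v)))"

definition smooth_trace_one :: "('n::finite cmat \<Rightarrow> 'b::real_normed_vector) \<Rightarrow> bool" where
  "smooth_trace_one f \<longleftrightarrow> (\<forall>k. Ck_trace_one k f)"

definition smooth_vector_field :: "('n::finite cmat \<Rightarrow> 'n cmat) \<Rightarrow> bool" where
  "smooth_vector_field \<Gamma> \<longleftrightarrow> (\<forall>\<xi>\<in>trace_one. \<Gamma> \<xi> \<in> trace_zero) \<and> smooth_trace_one \<Gamma>"

definition integral_curve :: "('n::finite cmat \<Rightarrow> 'n cmat) \<Rightarrow> (real \<Rightarrow> 'n cmat) \<Rightarrow> bool" where
  "integral_curve \<Gamma> \<gamma> \<longleftrightarrow>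
     (\<forall>t. \<gamma> t \<in> trace_one \<and> (\<gamma> has_vector_derivative \<Gamma> (\<gamma> t)) (at t))"

definition complete_vector_field :: "('n::finite cmat \<Rightarrow> 'n cmat) \<Rightarrow> bool" where
  "complete_vector_field \<Gamma> \<longleftrightarrow> (\<forall>\<xi>\<in>trace_one. \<exists>\<gamma>. integral_curve \<Gamma> \<gamma> \<and> \<gamma> 0 = \<xi>)"

definition flow_preserves_states :: "('n::finite cmat \<Rightarrow> 'n cmat) \<Rightarrow> bool" where
  "flow_preserves_states \<Gamma> \<longleftrightarrow>
     (\<forall>\<gamma>. integral_curve \<Gamma> \<gamma> \<and> \<gamma> 0 \<in> states \<longrightarrow> (\<forall>\<tau>\<ge>0. \<gamma> \<tau> \<in> states))"

definition lie_derivative ::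
    "('n::finite cmat \<Rightarrow> 'n cmat) \<Rightarrow> ('n cmat \<Rightarrow> real) \<Rightarrow> 'n cmat \<Rightarrow> real" where
  "lie_derivative \<Gamma> F \<xi> = frechet_derivative F (at \<xi> within trace_one) (\<Gamma> \<xi>)"

text \<open>The standing requirements on the vector field are part of the notion.\<close>

definition lasalle_function ::
    "('n::finite cmat \<Rightarrow> 'n cmat) \<Rightarrow> ('n cmat \<Rightarrow> real) \<Rightarrow> bool" where
  "lasalle_function \<Gamma> F \<longleftrightarrow>
     smooth_vector_field \<Gamma> \<and> complete_vector_field \<Gamma> \<and> flow_preserves_states \<Gamma> \<and>
     smooth_trace_one F \<and>
     (\<forall>\<xi>\<in>states. 0 \<le> F \<xi>) \<and>
     (\<forall>\<xi>\<in>states. lie_derivative \<Gamma> F \<xi> \<le> 0)"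

text \<open>The trace of the square of a self-adjoint matrix is real.\<close>

definition half_purity :: "'n::finite cmat \<Rightarrow> real" where
  "half_purity \<xi> = 1/2 * Re (trace (\<xi> ** \<xi>))"

end

theory Submission
  imports Defs
begin

text \<open>
  Conjugation \<open>V A = U A U\<^sup>\<dagger>\<close> is a linear isometry for the trace inner product, which on matrices
  is the real inner product of the library. Hence \<open>\<langle>\<xi>, V \<xi> - \<xi>\<rangle> \<le> 0\<close> by Cauchy-Schwarz, and this is
  the Lie derivative of half the purity. The flow is \<open>e\<^sup>-\<^sup>t \<Sum>\<^sub>k t\<^sup>k V\<^sup>k \<xi> / k!\<close>, which for
  \<open>t \<ge> 0\<close> is an infinite convex combination of the states \<open>V\<^sup>k \<xi>\<close> whenever \<open>\<xi>\<close> is a state.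
\<close>

subsection \<open>Conjugation by a unitary matrix\<close>

definition conjugate_by :: "'n::finite cmat \<Rightarrow> 'n cmat \<Rightarrow> 'n cmat" where
  "conjugate_by U A = U ** A ** dagger U"

lemma dagger_dagger [simp]: "dagger (dagger A) = A"
  by (simp add: dagger_def vec_eq_iff)

lemma dagger_matrix_mult: "dagger (A ** B) = dagger B ** dagger A"
  by (simp add: dagger_def matrix_matrix_mult_def vec_eq_iff mult.commute)

lemma dagger_mat_1 [simp]: "dagger (mat 1) = mat 1"
  by (auto simp: dagger_def mat_def vec_eq_iff)

text \<open>Linearity is over the reals, since \<open>dagger\<close> is conjugate-linear over the
  complex numbers; boundedness lets it pass through infinite sums.\<close>

lemma bounded_linear_dagger: "bounded_linear (dagger :: 'n::finite cmat \<Rightarrow> 'n cmat)"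
  unfolding linear_conv_bounded_linear[symmetric]
  by (rule linearI) (simp_all add: dagger_def vec_eq_iff)

lemma bounded_linear_trace: "bounded_linear (trace :: 'n::finite cmat \<Rightarrow> complex)"
  unfolding linear_conv_bounded_linear[symmetric]
  by (rule linearI) (simp_all add: trace_def sum.distrib scaleR_sum_right)

lemma trace_dagger: "trace (dagger A) = cnj (trace A)"
  by (simp add: trace_def dagger_def)

lemma bounded_linear_conjugate_by: "bounded_linear (conjugate_by U)"
  unfolding linear_conv_bounded_linear[symmetric]
  by (rule linearI)
    (simp_all add: conjugate_by_def matrix_matrix_mult_def vec_eq_iff sum.distrib algebra_simps
      scaleR_conv_of_real[where 'a = complex] sum_distrib_left)

text \<open>Both sides are the real part of the sum of \<open>A $ i $ j * cnj (B $ i $ j)\<close>,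
  so the library norm is the Frobenius norm.\<close>

lemma inner_cmat: "A \<bullet> B = Re (trace (A ** dagger B))" for A B :: "'n::finite cmat"
  by (simp add: inner_vec_def trace_def matrix_matrix_mult_def dagger_def inner_complex_def)

lemma inner_self_adjoint: "B \<in> self_adjoint \<Longrightarrow> A \<bullet> B = Re (trace (A ** B))"
  by (simp add: inner_cmat self_adjoint_def)

lemma dagger_conjugate_by: "dagger (conjugate_by U A) = conjugate_by U (dagger A)"
  by (simp add: conjugate_by_def dagger_matrix_mult matrix_mul_assoc)

lemma conjugate_by_mult:
  assumes "unitary_matrix U"
  shows "conjugate_by U A ** conjugate_by U B = conjugate_by U (A ** B)"
proof -
  have "conjugate_by U A ** conjugate_by U B = U ** A ** (dagger U ** U) ** B ** dagger U"
    by (simp add: conjugate_by_def matrix_mul_assoc)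
  also have "\<dots> = U ** A ** mat 1 ** B ** dagger U"
    using assms by (simp add: unitary_matrix_def)
  finally show ?thesis
    by (simp add: conjugate_by_def matrix_mul_assoc)
qed

lemma trace_conjugate_by:
  assumes "unitary_matrix U"
  shows "trace (conjugate_by U A) = trace A"
proof -
  have "trace (conjugate_by U A) = trace (dagger U ** U ** A)"
    unfolding conjugate_by_def by (metis trace_mul_sym matrix_mul_assoc)
  then show ?thesis
    using assms by (simp add: unitary_matrix_def)
qed

text \<open>The squared norm is the trace of \<open>A ** dagger A\<close>, and conjugation respects
  products, \<open>dagger\<close> and trace.\<close>

lemma norm_conjugate_by:
  assumes "unitary_matrix U"
  shows "norm (conjugate_by U A) = norm A"
  by (simp add: norm_eq_sqrt_inner inner_cmat dagger_conjugate_by conjugate_by_mult[OF assms]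
      trace_conjugate_by[OF assms])

section \<open>Expectation values and invariance of the states\<close>

lemma sesquilinear_dagger:
  "(\<Sum>i\<in>UNIV. cnj (v $ i) * (A *v w) $ i) = (\<Sum>i\<in>UNIV. cnj ((dagger A *v v) $ i) * w $ i)"
  for A :: "'n::finite cmat"
proof -
  have "(\<Sum>i\<in>UNIV. cnj (v $ i) * (A *v w) $ i) = (\<Sum>i\<in>UNIV. \<Sum>j\<in>UNIV. cnj (v $ i) * A $ i $ j * w $ j)"
    by (simp add: matrix_vector_mult_def sum_distrib_left mult.assoc)
  also have "\<dots> = (\<Sum>j\<in>UNIV. \<Sum>i\<in>UNIV. cnj (v $ i) * A $ i $ j * w $ j)"
    by (rule sum.swap)
  also have "\<dots> = (\<Sum>i\<in>UNIV. cnj ((dagger A *v v) $ i) * w $ i)"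
    by (simp add: matrix_vector_mult_def dagger_def sum_distrib_right sum_distrib_left mult_ac)
  finally show ?thesis .
qed

text \<open>With \<open>v\<close> fixed this is a bounded linear functional of the matrix, so
  positivity becomes a family of linear inequalities that survive convergent sums.\<close>

definition expectation_value :: "complex^'n::finite \<Rightarrow> 'n cmat \<Rightarrow> real" where
  "expectation_value v \<xi> = Re (\<Sum>i\<in>UNIV. cnj (v $ i) * (\<xi> *v v) $ i)"

lemma states_iff: "\<xi> \<in> states \<longleftrightarrow> \<xi> \<in> trace_one \<and> (\<forall>v. 0 \<le> expectation_value v \<xi>)"
  by (simp add: states_def expectation_value_def)

lemma bounded_linear_expectation_value: "bounded_linear (expectation_value v)"
  unfolding linear_conv_bounded_linear[symmetric]
  by (rule linearI)
    (simp_all add: expectation_value_def matrix_vector_mult_def sum.distrib algebra_simps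
      scaleR_sum_right sum_distrib_left)

text \<open>Moving \<open>U\<close> to the other slot of the Hermitian form only changes the test
  vector, whence conjugation preserves positivity.\<close>

lemma expectation_value_conjugate_by:
  "expectation_value v (conjugate_by U \<xi>) = expectation_value (dagger U *v v) \<xi>"
proof -
  have "conjugate_by U \<xi> *v v = U *v (\<xi> *v (dagger U *v v))"
    by (simp add: conjugate_by_def matrix_vector_mul_assoc matrix_mul_assoc)
  then show ?thesis
    by (simp add: expectation_value_def sesquilinear_dagger)
qed

lemma conjugate_by_self_adjoint: "A \<in> self_adjoint \<Longrightarrow> conjugate_by U A \<in> self_adjoint"
  by (simp add: self_adjoint_def dagger_conjugate_by)

lemma conjugate_by_trace_one:
  "unitary_matrix U \<Longrightarrow> \<xi> \<in> trace_one \<Longrightarrow> conjugate_by U \<xi> \<in> trace_one"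
  by (simp add: trace_one_def conjugate_by_self_adjoint trace_conjugate_by)

lemma conjugate_by_states:
  "unitary_matrix U \<Longrightarrow> \<xi> \<in> states \<Longrightarrow> conjugate_by U \<xi> \<in> states"
  by (simp add: states_iff conjugate_by_trace_one expectation_value_conjugate_by)

lemma poisson_generator_eq: "poisson_generator U \<xi> = conjugate_by U \<xi> - \<xi>"
  by (simp add: poisson_generator_def conjugate_by_def)

lemma bounded_linear_poisson_generator: "bounded_linear (poisson_generator U)"
  unfolding poisson_generator_eq
  by (intro bounded_linear_sub bounded_linear_conjugate_by bounded_linear_ident)

section \<open>The affine space of trace-one matrices and dissipativity of the generator\<close>

lemma subspace_self_adjoint: "subspace (self_adjoint :: 'n::finite cmat set)"
proof -
  interpret bounded_linear "dagger :: 'n cmat \<Rightarrow> 'n cmat" by (rule bounded_linear_dagger)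
  show ?thesis
    by (rule subspaceI) (simp_all add: self_adjoint_def zero add scaleR)
qed

lemma subspace_trace_zero: "subspace (trace_zero :: 'n::finite cmat set)"
proof -
  interpret bounded_linear "trace :: 'n cmat \<Rightarrow> complex" by (rule bounded_linear_trace)
  show ?thesis
    by (rule subspaceI)
      (simp_all add: trace_zero_def zero add scaleR subspace_0 subspace_add subspace_scale
        subspace_self_adjoint)
qed

lemma trace_one_add_trace_zero:
  assumes "\<xi> \<in> trace_one" "v \<in> trace_zero"
  shows "\<xi> + t *\<^sub>R v \<in> trace_one"
proof -
  interpret bounded_linear "trace :: 'a cmat \<Rightarrow> complex" by (rule bounded_linear_trace)
  show ?thesis
    using assms
    by (simp add: trace_one_def trace_zero_def add scaleR subspace_add subspace_scale
        subspace_self_adjoint)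
qed

lemma poisson_generator_trace_zero:
  assumes "unitary_matrix U" "\<xi> \<in> trace_one"
  shows "poisson_generator U \<xi> \<in> trace_zero"
  using assms
  by (simp add: subspace_self_adjoint poisson_generator_eq trace_one_def trace_zero_def trace_sub
      trace_conjugate_by conjugate_by_self_adjoint subspace_diff)

text \<open>Dissipativity, for arbitrary matrices: it applies to states for the Lie derivative and
  to differences of integral curves for uniqueness.\<close>

lemma inner_poisson_generator_le_0:
  assumes "unitary_matrix U"
  shows "\<xi> \<bullet> poisson_generator U \<xi> \<le> 0"
proof -
  have "\<xi> \<bullet> conjugate_by U \<xi> \<le> norm \<xi> * norm \<xi>"
    using norm_cauchy_schwarz[of \<xi> "conjugate_by U \<xi>"] by (simp add: norm_conjugate_by[OF assms])
  then show ?thesis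
    by (simp add: poisson_generator_eq inner_diff_right power2_eq_square flip: power2_norm_eq_inner)
qed

subsection \<open>Exponential series of a linear map\<close>

text \<open>This is \<open>exp (t A) x\<close>, built from iterates applied to the vector, so that
  no algebra of operators is involved.\<close>

definition exp_series :: "('a::real_normed_vector \<Rightarrow> 'a) \<Rightarrow> 'a \<Rightarrow> real \<Rightarrow> 'a" where
  "exp_series A x t = (\<Sum>k. (t ^ k / fact k) *\<^sub>R (A ^^ k) x)"

text \<open>If \<open>K\<close> bounds \<open>A\<close>, the terms are dominated by those of the
  real series for \<open>exp (\<bar>t\<bar> * K)\<close>, scaled by \<open>norm x\<close>.\<close>

lemma summable_exp_series:
  fixes A :: "'a::banach \<Rightarrow> 'a"
  assumes "bounded_linear A"
  shows "summable (\<lambda>k. (t ^ k / fact k) *\<^sub>R (A ^^ k) x)"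
proof -
  obtain K where K: "K \<ge> 0" "\<And>y. norm (A y) \<le> norm y * K"
    using bounded_linear.nonneg_bounded[OF assms] by blast
  have bound: "norm ((A ^^ k) x) \<le> K ^ k * norm x" for k
  proof (induction k)
    case (Suc k)
    have "norm ((A ^^ Suc k) x) \<le> norm ((A ^^ k) x) * K"
      using K(2) by simp
    also have "\<dots> \<le> K ^ k * norm x * K"
      using Suc K(1) by (rule mult_right_mono)
    finally show ?case by (simp add: mult_ac)
  qed simp
  have "summable (\<lambda>k. norm x * (inverse (fact k) * (\<bar>t\<bar> * K) ^ k))"
    by (intro summable_mult summable_exp)
  moreover have "norm ((t ^ k / fact k) *\<^sub>R (A ^^ k) x) \<le> norm x * (inverse (fact k) * (\<bar>t\<bar> * K) ^ k)"
    for k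
  proof -
    have "norm ((t ^ k / fact k) *\<^sub>R (A ^^ k) x) = \<bar>t\<bar> ^ k / fact k * norm ((A ^^ k) x)"
      by (simp add: power_abs)
    also have "\<dots> \<le> \<bar>t\<bar> ^ k / fact k * (K ^ k * norm x)"
      by (intro mult_left_mono bound) simp
    finally show ?thesis by (simp add: field_simps power_mult_distrib)
  qed
  ultimately show ?thesis
    by (rule summable_comparison_test')
qed

text \<open>Transfers properties of the iterates to the sum; \<open>h\<close> will be
  \<open>dagger\<close>, the trace, an expectation value or a coordinate functional.\<close>

lemma bounded_linear_exp_series:
  fixes A :: "'a::banach \<Rightarrow> 'a"
  assumes "bounded_linear h" "bounded_linear A"
  shows "h (exp_series A x t) = (\<Sum>k. (t ^ k / fact k) *\<^sub>R h ((A ^^ k) x))"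
  unfolding exp_series_def bounded_linear.suminf[OF assms(1) summable_exp_series[OF assms(2)]]
  by (simp add: linear_scale[OF bounded_linear.linear[OF assms(1)]])

lemma exp_series_0 [simp]: "exp_series A x 0 = x"
proof -
  \<comment> \<open>Only the term at index 0 survives, with \<open>0 ^ 0 = 1\<close>.\<close>
  have "exp_series A x 0 = (\<Sum>k\<in>{0}. (0 ^ k / fact k) *\<^sub>R (A ^^ k) x)"
    unfolding exp_series_def by (rule suminf_finite) auto
  then show ?thesis by simp
qed

text \<open>Each coordinate is a real power series in \<open>t\<close> converging everywhere, so it
  may be differentiated term by term.\<close>

lemma has_vector_derivative_exp_series:
  fixes A :: "'a::euclidean_space \<Rightarrow> 'a"
  assumes "bounded_linear A"
  shows "(exp_series A x has_vector_derivative A (exp_series A x t)) (at t)"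
proof -
  have "((\<lambda>s. exp_series A x s \<bullet> b) has_derivative (\<lambda>s. (s *\<^sub>R A (exp_series A x t)) \<bullet> b)) (at t)"
    for b
  proof -
    define c where "c k = ((A ^^ k) x \<bullet> b) / fact k" for k
    have series: "exp_series A x s \<bullet> b = (\<Sum>k. c k * s ^ k)" for s
      using bounded_linear_exp_series[OF bounded_linear_inner_left[of b] assms, of x s]
      by (simp add: c_def mult_ac)
    have "summable (\<lambda>k. c k * s ^ k)" for s
      using bounded_linear.summable[OF bounded_linear_inner_left[of b]
          summable_exp_series[OF assms, of s x]]
      by (simp add: c_def mult_ac)
    then have "((\<lambda>s. \<Sum>k. c k * s ^ k) has_real_derivative (\<Sum>k. diffs c k * t ^ k)) (at t)"
      by (rule termdiffs_strong_converges_everywhere)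
    moreover have "(\<Sum>k. diffs c k * t ^ k) = A (exp_series A x t) \<bullet> b"
    proof -
      \<comment> \<open>The factor \<open>Suc k\<close> from differentiation cancels against
        \<open>fact (Suc k)\<close>, leaving one extra application of \<open>A\<close>.\<close>
      have "diffs c k = (A ((A ^^ k) x) \<bullet> b) / fact k" for k
        by (simp add: diffs_def c_def del: of_nat_Suc)
      then show ?thesis
        using bounded_linear_exp_series[OF bounded_linear_compose[OF
              bounded_linear_inner_left[of b] assms] assms, of x t]
        by (simp add: mult_ac)
    qed
    ultimately show ?thesis
      by (simp add: series has_field_derivative_def mult_commute_abs)
  qed
  then show ?thesis
    unfolding has_vector_derivative_def by (subst has_derivative_componentwise_within) blast
qed


text \<open>All iterates have trace 1, so the series has trace \<open>exp t\<close>, which the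
  prefactor normalises. This covers negative times too, as completeness demands.\<close>

lemma exp_series_trace_one:
  fixes A :: "'n::finite cmat \<Rightarrow> 'n cmat"
  assumes "bounded_linear A" and A: "\<And>\<eta>. \<eta> \<in> trace_one \<Longrightarrow> A \<eta> \<in> trace_one"
    and "\<xi> \<in> trace_one"
  shows "exp (- t) *\<^sub>R exp_series A \<xi> t \<in> trace_one"
proof -
  have pow: "(A ^^ k) \<xi> \<in> trace_one" for k
    by (induction k) (simp_all add: assms)
  have "dagger (exp_series A \<xi> t) = exp_series A \<xi> t"
    using pow unfolding bounded_linear_exp_series[OF bounded_linear_dagger assms(1)]
    by (simp add: exp_series_def trace_one_def self_adjoint_def)
  then have "exp_series A \<xi> t \<in> self_adjoint"
    by (simp add: self_adjoint_def)
  moreover have "trace (exp_series A \<xi> t) = (exp t) *\<^sub>R 1"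
  proof -
    have "trace (exp_series A \<xi> t) = (\<Sum>k. (t ^ k / fact k) *\<^sub>R 1)"
      using pow unfolding bounded_linear_exp_series[OF bounded_linear_trace assms(1)]
      by (simp add: trace_one_def)
    also have "\<dots> = (\<Sum>k. t ^ k / fact k) *\<^sub>R 1"
      using summable_exp[of t] by (intro suminf_scaleR_left[symmetric]) (simp add: field_simps)
    finally show ?thesis
      by (simp add: exp_def field_simps)
  qed
  ultimately show ?thesis
    by (simp add: trace_one_def subspace_scale subspace_self_adjoint
        linear_scale[OF bounded_linear.linear[OF bounded_linear_trace]]
        flip: exp_add of_real_mult scaleR_conv_of_real)
qed

text \<open>For \<open>t \<ge> 0\<close> the coefficients are nonnegative, so every expectation
  value is a sum of nonnegative terms.\<close>

lemma exp_series_states: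
  fixes A :: "'n::finite cmat \<Rightarrow> 'n cmat"
  assumes "bounded_linear A" and "\<And>\<eta>. \<eta> \<in> trace_one \<Longrightarrow> A \<eta> \<in> trace_one"
    and A: "\<And>\<eta>. \<eta> \<in> states \<Longrightarrow> A \<eta> \<in> states" and "\<xi> \<in> states" "0 \<le> t"
  shows "exp (- t) *\<^sub>R exp_series A \<xi> t \<in> states"
proof -
  have "(A ^^ k) \<xi> \<in> states" for k
    by (induction k) (simp_all add: assms)
  then have pow: "0 \<le> expectation_value v ((A ^^ k) \<xi>)" for v k
    by (simp add: states_iff)
  have "0 \<le> expectation_value v (exp_series A \<xi> t)" for v
    using bounded_linear.summable[OF bounded_linear_expectation_value
        summable_exp_series[OF assms(1)], of v t \<xi>] pow \<open>0 \<le> t\<close>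
    unfolding bounded_linear_exp_series[OF bounded_linear_expectation_value assms(1)]
    by (intro suminf_nonneg)
      (simp_all add: linear_scale[OF bounded_linear.linear[OF bounded_linear_expectation_value]])
  then have "0 \<le> expectation_value v (exp (- t) *\<^sub>R exp_series A \<xi> t)" for v
    by (simp add: linear_scale[OF bounded_linear.linear[OF bounded_linear_expectation_value]])
  moreover have "exp (- t) *\<^sub>R exp_series A \<xi> t \<in> trace_one"
    using assms by (intro exp_series_trace_one) (simp_all add: states_iff)
  ultimately show ?thesis
    by (simp add: states_iff)
qed

subsection \<open>The Poisson flow\<close>

text \<open>The generator is conjugation minus the identity; these commute, so its exponential
  factors into \<open>exp (- t)\<close> and the exponential of conjugation.\<close>

definition poisson_flow :: "'n::finite cmat \<Rightarrow> real \<Rightarrow> 'n cmat \<Rightarrow> 'n cmat" where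
  "poisson_flow U t \<xi> = exp (- t) *\<^sub>R exp_series (conjugate_by U) \<xi> t"

lemma has_vector_derivative_poisson_flow:
  "((\<lambda>t. poisson_flow U t \<xi>) has_vector_derivative poisson_generator U (poisson_flow U t \<xi>)) (at t)"
proof -
  have "((\<lambda>t. exp (- t)) has_real_derivative - exp (- t)) (at t)"
    by (auto intro!: derivative_eq_intros)
  from has_vector_derivative_scaleR[OF this
      has_vector_derivative_exp_series[OF bounded_linear_conjugate_by, of U \<xi> t]]
  show ?thesis
    by (simp add: poisson_flow_def poisson_generator_eq
        linear_scale[OF bounded_linear.linear[OF bounded_linear_conjugate_by]])
qed

lemma integral_curve_poisson_flow:
  assumes "unitary_matrix U" "\<xi> \<in> trace_one"
  shows "integral_curve (gkls_vector_field (poisson_generator U)) (\<lambda>t. poisson_flow U t \<xi>)"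
proof -
  have "poisson_flow U t \<xi> \<in> trace_one" for t
    unfolding poisson_flow_def using assms
    by (intro exp_series_trace_one bounded_linear_conjugate_by conjugate_by_trace_one)
  then show ?thesis
    by (simp add: integral_curve_def gkls_vector_field_def has_vector_derivative_poisson_flow)
qed

text \<open>Dissipativity of the generator makes the distance between two integral curves nonincreasing.\<close>

lemma integral_curve_unique:
  assumes "unitary_matrix U"
    and curves: "integral_curve (gkls_vector_field (poisson_generator U)) \<gamma>"
      "integral_curve (gkls_vector_field (poisson_generator U)) \<gamma>'"
    and "\<gamma> 0 = \<gamma>' 0" "0 \<le> t"
  shows "\<gamma> t = \<gamma>' t"
proof -
  interpret L: bounded_linear "poisson_generator U" by (rule bounded_linear_poisson_generator)
  define \<delta> where "\<delta> s = \<gamma> s - \<gamma>' s" for s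
  \<comment> \<open>By linearity of the generator the difference of the curves solves the same
    equation.\<close>
  have \<delta>: "(\<delta> has_vector_derivative poisson_generator U (\<delta> s)) (at s)" for s
    using curves unfolding integral_curve_def gkls_vector_field_def \<delta>_def L.diff
    by (intro has_vector_derivative_diff) (metis (full_types))+
  have deriv: "((\<lambda>s. \<delta> s \<bullet> \<delta> s) has_real_derivative 2 * (\<delta> s \<bullet> poisson_generator U (\<delta> s))) (at s)" for s
    using has_derivative_inner[OF \<delta>[unfolded has_vector_derivative_def] \<delta>[unfolded has_vector_derivative_def]]
    by (simp add: has_field_derivative_def inner_commute mult_commute_abs algebra_simps)
  have "\<delta> t \<bullet> \<delta> t \<le> \<delta> 0 \<bullet> \<delta> 0"
  proof (rule DERIV_nonpos_imp_nonincreasing[OF \<open>0 \<le> t\<close>])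
    show "\<exists>y. ((\<lambda>s. \<delta> s \<bullet> \<delta> s) has_real_derivative y) (at s) \<and> y \<le> 0" for s
      using deriv[of s] inner_poisson_generator_le_0[OF assms(1), of "\<delta> s"]
      by (intro exI[of _ "2 * (\<delta> s \<bullet> poisson_generator U (\<delta> s))"]) simp
  qed
  then show ?thesis
    using \<open>\<gamma> 0 = \<gamma>' 0\<close> by (simp add: \<delta>_def flip: power2_norm_eq_inner)
qed

text \<open>The claim concerns every integral curve; uniqueness forward in time identifies each with
  the explicit flow.\<close>

lemma flow_preserves_states_poisson:
  assumes "unitary_matrix U"
  shows "flow_preserves_states (gkls_vector_field (poisson_generator U))"
  unfolding flow_preserves_states_def
proof (intro allI impI, elim conjE)
  fix \<gamma> :: "real \<Rightarrow> 'a cmat" and t :: real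
  assume \<gamma>: "integral_curve (gkls_vector_field (poisson_generator U)) \<gamma>"
    and "\<gamma> 0 \<in> states" "0 \<le> t"
  have "\<gamma> 0 \<in> trace_one"
    using \<open>\<gamma> 0 \<in> states\<close> by (simp add: states_iff)
  have "\<gamma> t = poisson_flow U t (\<gamma> 0)"
    by (rule integral_curve_unique[OF assms \<gamma> integral_curve_poisson_flow[OF assms \<open>\<gamma> 0 \<in> trace_one\<close>]])
      (simp_all add: poisson_flow_def \<open>0 \<le> t\<close>)
  also have "\<dots> \<in> states"
    unfolding poisson_flow_def
    by (intro exp_series_states bounded_linear_conjugate_by conjugate_by_trace_one
        conjugate_by_states assms \<open>\<gamma> 0 \<in> states\<close> \<open>0 \<le> t\<close>)
  finally show "\<gamma> t \<in> states" .
qed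

lemma complete_vector_field_poisson:
  assumes "unitary_matrix U"
  shows "complete_vector_field (gkls_vector_field (poisson_generator U))"
  unfolding complete_vector_field_def
proof
  fix \<xi> :: "'a cmat"
  assume "\<xi> \<in> trace_one"
  then show "\<exists>\<gamma>. integral_curve (gkls_vector_field (poisson_generator U)) \<gamma> \<and> \<gamma> 0 = \<xi>"
    using integral_curve_poisson_flow[OF assms]
    by (intro exI[of _ "\<lambda>t. poisson_flow U t \<xi>"]) (simp add: poisson_flow_def)
qed

subsection \<open>Smoothness and the Lie derivative\<close>

lemma Ck_trace_one_const: "Ck_trace_one k (\<lambda>\<xi>. c)"
proof (induction k arbitrary: c)
  case (Suc k)
  show ?case
    \<comment> \<open>The derivative is again constant, with value 0; hence the induction over
      arbitrary \<open>c\<close>.\<close>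
    using Suc[of 0] by (auto intro!: exI[of _ "\<lambda>\<xi> v. 0"])
qed simp

text \<open>Directional derivatives of a linear map are constant. Agreement on
  \<open>trace_one\<close> is enough, which accommodates the cutoff in
  \<open>gkls_vector_field\<close>.\<close>

lemma Ck_trace_one_bounded_linear:
  assumes "bounded_linear h" and h: "\<And>\<xi>. \<xi> \<in> trace_one \<Longrightarrow> f \<xi> = h \<xi>"
  shows "Ck_trace_one k f"
proof (cases k)
  case 0
  have "continuous_on trace_one h"
    by (intro linear_continuous_on assms)
  then show ?thesis
    using 0 h continuous_on_cong[of trace_one trace_one f h] by simp
next
  case (Suc m)
  have "(f has_derivative h) (at \<xi> within trace_one)" if "\<xi> \<in> trace_one" for \<xi>
    using that h bounded_linear_imp_has_derivative[OF assms(1)] by (rule has_derivative_transform)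
  then show ?thesis
    using Suc by (auto intro!: exI[of _ "\<lambda>\<xi>. h"] Ck_trace_one_const)
qed

lemma half_purity_self_adjoint: "\<xi> \<in> self_adjoint \<Longrightarrow> half_purity \<xi> = 1/2 * (\<xi> \<bullet> \<xi>)"
  by (simp add: half_purity_def inner_self_adjoint)

text \<open>On self-adjoint matrices the function is half the squared norm, whose gradient at \<xi>
  is \<xi> itself.\<close>

lemma half_purity_has_derivative:
  assumes "\<xi> \<in> trace_one"
  shows "(half_purity has_derivative (\<bullet>) \<xi>) (at \<xi> within trace_one)"
proof (rule has_derivative_transform[OF assms])
  show "((\<lambda>\<xi>. 1/2 * (\<xi> \<bullet> \<xi>)) has_derivative (\<bullet>) \<xi>) (at \<xi> within trace_one)"
    by (auto intro!: derivative_eq_intros simp: inner_commute)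
qed (simp add: half_purity_self_adjoint trace_one_def)

lemma smooth_trace_one_half_purity: "smooth_trace_one half_purity"
  unfolding smooth_trace_one_def
proof
  fix k
  show "Ck_trace_one k (half_purity :: 'a cmat \<Rightarrow> real)"
  proof (cases k)
    case 0
    then show ?thesis
      by (auto simp: continuous_on_eq_continuous_within
          intro: has_derivative_continuous half_purity_has_derivative)
  next
    case (Suc m)
    \<comment> \<open>Along \<open>v\<close> the derivative is the linear function
      \<open>\<xi> \<bullet> v\<close> of \<xi>, so the linear case finishes.\<close>
    show ?thesis
      unfolding Suc Ck_trace_one.simps
      by (intro exI[of _ "(\<bullet>)"] conjI ballI half_purity_has_derivative
          Ck_trace_one_bounded_linear[OF bounded_linear_inner_left]) auto
  qed
qed

lemma smooth_vector_field_poisson: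
  assumes "unitary_matrix U"
  shows "smooth_vector_field (gkls_vector_field (poisson_generator U))"
  unfolding smooth_vector_field_def smooth_trace_one_def
  by (intro conjI ballI allI Ck_trace_one_bounded_linear[OF bounded_linear_poisson_generator])
    (simp_all add: gkls_vector_field_def poisson_generator_trace_zero assms)

text \<open>
  \<^const>\<open>trace_one\<close> has empty interior, so \<^const>\<open>frechet_derivative\<close> is an arbitrary choice among
  several derivatives; restricting to a line through \<open>\<xi>\<close> shows that they agree on tangent vectors.
\<close>

lemma frechet_derivative_trace_one:
  assumes F: "(F has_derivative F') (at \<xi> within trace_one)"
    and "\<xi> \<in> trace_one" and v: "v \<in> trace_zero"
  shows "frechet_derivative F (at \<xi> within trace_one) v = F' v"
proof -
  let ?l = "\<lambda>t::real. \<xi> + t *\<^sub>R v"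
  have line: "((\<lambda>t. F (?l t)) has_derivative (\<lambda>t. D (t *\<^sub>R v))) (at 0)"
    if "(F has_derivative D) (at \<xi> within trace_one)" for D
  proof -
    have "(F has_derivative D) (at (?l 0) within range ?l)"
      using that trace_one_add_trace_zero[OF assms(2) v]
      by (auto intro: has_derivative_subset)
    moreover have "(?l has_derivative (\<lambda>t. t *\<^sub>R v)) (at 0)"
      by (auto intro!: derivative_eq_intros)
    ultimately show ?thesis
      by (rule has_derivative_in_compose[rotated])
  qed
  have "(F has_derivative frechet_derivative F (at \<xi> within trace_one)) (at \<xi> within trace_one)"
    using F by (auto simp: frechet_derivative_works[symmetric] differentiable_def)
  \<comment> \<open>Derivatives of a function of a real variable at 0 are unique; evaluating both at
    1 gives the claim.\<close>
  from has_derivative_unique[OF line[OF this] line[OF F]] show ?thesis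
    by (metis scaleR_one)
qed

text \<open>The Lie derivative is the inner product of \<xi> with its image under the
  generator.\<close>

lemma lie_derivative_half_purity_le_0:
  assumes "unitary_matrix U" "\<xi> \<in> trace_one"
  shows "lie_derivative (gkls_vector_field (poisson_generator U)) half_purity \<xi> \<le> 0"
  using assms frechet_derivative_trace_one[OF half_purity_has_derivative[OF assms(2)] assms(2)
      poisson_generator_trace_zero[OF assms]]
  by (simp add: lie_derivative_def gkls_vector_field_def inner_poisson_generator_le_0)

lemma lasalle_function_half_purity:
  assumes "unitary_matrix U"
  shows "lasalle_function (gkls_vector_field (poisson_generator U)) half_purity"
  using assms
  by (auto simp: lasalle_function_def smooth_vector_field_poisson complete_vector_field_poisson
      flow_preserves_states_poisson smooth_trace_one_half_purity states_iff trace_one_def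
      half_purity_self_adjoint intro!: lie_derivative_half_purity_le_0)

subsection \<open>Coordinates\<close>

lemma basis_inner:
  fixes e :: "nat \<Rightarrow> 'n::finite cmat"
  assumes "trace_orthonormal_basis e" "k < CARD('n)\<^sup>2" "l < CARD('n)\<^sup>2"
  shows "e k \<bullet> e l = (if k = l then 1 else 0)"
  using assms by (simp add: trace_orthonormal_basis_def inner_self_adjoint)

lemma inner_basis_0:
  fixes e :: "nat \<Rightarrow> 'n::finite cmat"
  assumes "trace_orthonormal_basis e"
  shows "A \<bullet> e 0 = 1 / sqrt (real CARD('n)) * Re (trace A)"
proof -
  have "A \<bullet> e 0 = 1 / sqrt (real CARD('n)) * (A \<bullet> mat 1)"
    using assms by (simp add: trace_orthonormal_basis_def)
  then show ?thesis
    by (simp add: inner_cmat)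
qed

text \<open>Self-adjointness makes the trace real, and orthogonality to \<open>e 0\<close>, a
  multiple of the identity, makes it vanish.\<close>

lemma basis_trace_zero:
  fixes e :: "nat \<Rightarrow> 'n::finite cmat"
  assumes e: "trace_orthonormal_basis e" and "k \<in> {1..<CARD('n)\<^sup>2}"
  shows "e k \<in> trace_zero"
proof -
  have "e k \<in> self_adjoint"
    using assms by (simp add: trace_orthonormal_basis_def)
  then have "trace (e k) = cnj (trace (e k))"
    by (simp add: self_adjoint_def flip: trace_dagger)
  then have "Im (trace (e k)) = 0"
    by (simp add: complex_eq_iff)
  moreover have "Re (trace (e k)) = 0"
    using inner_basis_0[OF e, of "e k"] basis_inner[OF e, of k 0] assms by simp
  ultimately show ?thesis
    using \<open>e k \<in> self_adjoint\<close> by (simp add: trace_zero_def complex_eq_iff)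
qed

lemma trace_zero_basis_expand:
  fixes e :: "nat \<Rightarrow> 'n::finite cmat"
  assumes e: "trace_orthonormal_basis e" and "v \<in> trace_zero"
  shows "v = (\<Sum>k\<in>{1..<CARD('n)\<^sup>2}. (v \<bullet> e k) *\<^sub>R e k)"
proof -
  let ?I = "{..<CARD('n)\<^sup>2}"
  \<comment> \<open>The library expansion sums over a set of vectors; injectivity turns it into a
    sum over indices.\<close>
  have inj: "inj_on e ?I"
    by (rule inj_onI) (metis basis_inner[OF e] lessThan_iff zero_neq_one)
  have "v \<in> span (e ` ?I)"
    using assms by (simp add: trace_orthonormal_basis_def trace_zero_def)
  then have "v = (\<Sum>b\<in>e ` ?I. (v \<bullet> b) *\<^sub>R b)"
    by (intro orthonormal_basis_expand[symmetric])
      (auto simp: pairwise_def orthogonal_def basis_inner[OF e] norm_eq_sqrt_inner)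
  also have "\<dots> = (\<Sum>k\<in>?I. (v \<bullet> e k) *\<^sub>R e k)"
    using inj by (simp add: sum.reindex)
  \<comment> \<open>The coefficient at index 0 is proportional to the trace of \<open>v\<close>,
    hence zero.\<close>
  also have "\<dots> = (\<Sum>k\<in>{1..<CARD('n)\<^sup>2}. (v \<bullet> e k) *\<^sub>R e k)"
    using assms(2)
    by (intro sum.mono_neutral_right) (auto simp: not_le inner_basis_0[OF e] trace_zero_def)
  finally show ?thesis .
qed

lemma point_of_coords_eq:
  fixes e :: "nat \<Rightarrow> 'n::finite cmat"
  assumes "trace_orthonormal_basis e"
  shows "point_of_coords e x = (1 / CARD('n)) *\<^sub>R mat 1 + (\<Sum>l\<in>{1..<CARD('n)\<^sup>2}. x l *\<^sub>R e l)"
  using assms by (simp add: point_of_coords_def trace_orthonormal_basis_def)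

lemma point_of_coords_trace_one:
  fixes e :: "nat \<Rightarrow> 'n::finite cmat"
  assumes e: "trace_orthonormal_basis e"
  shows "point_of_coords e x \<in> trace_one"
proof -
  have "(\<Sum>l\<in>{1..<CARD('n)\<^sup>2}. x l *\<^sub>R e l) \<in> trace_zero"
    by (intro subspace_sum subspace_scale subspace_trace_zero basis_trace_zero[OF e])
  moreover have "(1 / CARD('n)) *\<^sub>R mat 1 \<in> (trace_one :: 'n cmat set)"
  proof -
    have "(1 / CARD('n)) *\<^sub>R mat 1 \<in> (self_adjoint :: 'n cmat set)"
      by (intro subspace_scale subspace_self_adjoint) (simp add: self_adjoint_def)
    then show ?thesis
      by (simp add: trace_one_def trace_I scaleR_conv_of_real[where 'a = complex]
          linear_scale[OF bounded_linear.linear[OF bounded_linear_trace]])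
  qed
  ultimately show ?thesis
    unfolding point_of_coords_eq[OF e] using trace_one_add_trace_zero[where t = 1] by fastforce
qed

theorem proposition8:
  fixes U :: "complex^'n::finite^'n" and e :: "nat \<Rightarrow> complex^'n^'n"
  assumes "unitary_matrix U"
    and "trace_orthonormal_basis e"
  defines "\<Gamma> \<equiv> gkls_vector_field (poisson_generator U)"
  shows "(\<forall>x :: nat \<Rightarrow> real. \<Gamma> (point_of_coords e x) =
            (\<Sum>k\<in>{1..<CARD('n)\<^sup>2}.
               (\<Sum>l\<in>{1..<CARD('n)\<^sup>2}. Re (trace (U ** e l ** dagger U ** e k)) * x l) *\<^sub>R e k)
            - (\<Sum>k\<in>{1..<CARD('n)\<^sup>2}. x k *\<^sub>R e k))
       \<and> lasalle_function \<Gamma> half_purity"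
proof (intro conjI allI)
  show "lasalle_function \<Gamma> half_purity"
    unfolding \<Gamma>_def by (rule lasalle_function_half_purity[OF assms(1)])
  fix x :: "nat \<Rightarrow> real"
  let ?I = "{1..<CARD('n)\<^sup>2}"
  let ?V = "conjugate_by U"
  interpret V: bounded_linear ?V by (rule bounded_linear_conjugate_by)
  note e = assms(2)
  have inner: "?V (e l) \<bullet> e k = Re (trace (U ** e l ** dagger U ** e k))" if "k \<in> ?I" for k l
    using that e by (simp add: inner_self_adjoint conjugate_by_def trace_orthonormal_basis_def)
  \<comment> \<open>Conjugation keeps the traceless matrices invariant, so the image expands in the
    \<open>e k\<close> with \<open>k \<ge> 1\<close>.\<close>
  have "?V (e l) \<in> trace_zero" if "l \<in> ?I" for l
    using basis_trace_zero[OF e that]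
    by (simp add: trace_zero_def conjugate_by_self_adjoint trace_conjugate_by[OF assms(1)])
  then have "(\<Sum>l\<in>?I. x l *\<^sub>R ?V (e l)) \<in> trace_zero"
    by (intro subspace_sum subspace_scale subspace_trace_zero)
  from trace_zero_basis_expand[OF e this]
  have expand: "(\<Sum>l\<in>?I. x l *\<^sub>R ?V (e l)) =
      (\<Sum>k\<in>?I. (\<Sum>l\<in>?I. Re (trace (U ** e l ** dagger U ** e k)) * x l) *\<^sub>R e k)"
    by (simp add: inner_sum_left inner mult.commute)
  \<comment> \<open>Conjugation fixes the identity, so the constant part of the point cancels and
    the field is homogeneous linear in \<open>x\<close>.\<close>
  have "?V (mat 1) = mat 1"
    using assms(1) by (simp add: conjugate_by_def unitary_matrix_def)
  then have "\<Gamma> (point_of_coords e x) = (\<Sum>l\<in>?I. x l *\<^sub>R ?V (e l)) - (\<Sum>l\<in>?I. x l *\<^sub>R e l)"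
    using point_of_coords_trace_one[OF e, of x]
    by (simp add: \<Gamma>_def gkls_vector_field_def poisson_generator_eq point_of_coords_eq[OF e]
        V.add V.scaleR V.sum)
  then show "\<Gamma> (point_of_coords e x) =
      (\<Sum>k\<in>?I. (\<Sum>l\<in>?I. Re (trace (U ** e l ** dagger U ** e k)) * x l) *\<^sub>R e k)
      - (\<Sum>k\<in>?I. x k *\<^sub>R e k)"
    unfolding expand .
qed

end
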